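(* Each of the logics $\mathbf{DL}(\partial)$ and $\mathbf{DL}(\partial^* )$ can simulate each of the logics $\mathbf{DL}(\delta)$ and $\mathbf{DL}(\delta^* )$ with respect to addition of facts. Explicitly, for every $L_1 \in \{\mathbf{DL}(\delta),\mathbf{DL}(\delta^* )\}$ with principal tag $d_1$, for every $L_2 \in \{\mathbf{DL}(\partial),\mathbf{DL}(\partial^* )\}$ with principal tag $d_2$, and for every defeasible theory $D_1$, there is a defeasible theory $D_2$ with the following property. For every theory $A=(F_A,\emptyset,\emptyset)$ consisting only of facts that is modular with respect to $D_1$ and $D_2$, and for every literal $q \in \Sigma(D_1+A)$: - $D_1+A \vdash +d_1 q$ in $L_1$ iff $D_2+A \vdash +d_2 q$ in $L_2$, and - $D_1+A \vdash -d_1 q$ in $L_1$ iff $D_2+A \vdash -d_2 q$ in $L_2$.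
   Context: Defeasible theories. Literals come from a language closed under negation. For a literal $q$, its complement ${\sim}q$ is $\neg p$ if $q=p$ is a proposition, and $p$ if $q=\neg p$. A defeasible theory $D=(F,R,>)$ consists of: - a set $F$ of literals (the facts); - a finite set $R$ of rules, each with a distinct label; - an acyclic binary relation $>$ on labels (the superiority relation). Each rule $r$ has a finite set $A(r)$ of body literals and a head literal. A rule is one of: - strict, written $A(r)\rightarrow q$; - defeasible, written $A(r)\Rightarrow q$; - a defeater, written $A(r)\leadsto q$. Notation: $R_s$ is the set of strict rules, $R_{sd}$ the set of strict or defeasible rules, and $R[q]$, $R_s[q]$, $R_{sd}[q]$ are the corresponding sets of rules with head $q$. $\Sigma(D)$ and $\Lambda(D)$ are the literals and the labels occurring in $D$. Conclusions. Conclusions have the form $+d\,q$ or $-d\,q$ for a tag $d \in \{\Delta,\partial,\partial^*,\delta,\sigma,\delta^*,\sigma^*\}$. Given $D$, an operator $\mathcal T_D$ maps sets $E$ of conclusions to sets of conclusions. The conclusions of $D$ are $\bigcup_n \mathcal T_D\uparrow n$, where $\mathcal T_D\uparrow 0=\emptyset$ and $\mathcal T_D\uparrow(n+1)=\mathcal T_D(\mathcal T_D\uparrow n)$. We write $D\vdash\alpha$ when $\alpha$ is a conclusion of $D$. For a set $B$ of literals, "$+d B\subseteq E$" means $+d\,a\in E$ for all $a\in B$. The operator $\mathcal T_D$ is defined by the following clauses. $+\Delta q\in\mathcal T_D(E)$ iff $q\in F$, or there is $r\in R_s[q]$ with $+\Delta A(r)\subseteq E$. $-\Delta q\in\mathcal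 T_D(E)$ iff $q\notin F$ and every $r\in R_s[q]$ has some $a\in A(r)$ with $-\Delta a\in E$. $+\partial q\in \mathcal T_D(E)$ iff either $+\Delta q\in E$, or all of the following hold: - some $r\in R_{sd}[q]$ has $+\partial A(r)\subseteq E$; - $-\Delta{\sim}q\in E$; - every $s\in R[{\sim}q]$ either has some $a\in A(s)$ with $-\partial a\in E$, or there is $t\in R_{sd}[q]$ with $+\partial A(t)\subseteq E$ and $t>s$. $-\partial q\in\mathcal T_D(E)$ iff $-\Delta q\in E$ and one of the following holds: - every $r\in R_{sd}[q]$ has some $a\in A(r)$ with $-\partial a\in E$; - $+\Delta{\sim}q\in E$; - some $s\in R[{\sim}q]$ has $+\partial A(s)\subseteq E$ and every $t\in R_{sd}[q]$ either has some $a\in A(t)$ with $-\partial a\in E$ or satisfies not $t>s$. $+\partial^* q\in\mathcal T_D(E)$ iff either $+\Delta q\in E$, or there is $r\in R_{sd}[q]$ such that: - $+\partial^*A(r)\subseteq E$; - $-\Delta{\sim}q\in E$; - every $s\in R[{\sim}q]$ either has some $a\in A(s)$ with $-\partial^* a\in E$, or satisfies $r>s$. $-\partial^* q\in\mathcal T_D(E)$ iff $-\Delta q\in E$ and every $r\in R_{sd}[q]$ satisfies one of: - some $a\in A(r)$ has $-\partial^*a\in E$; - $+\Delta{\sim}q\in E$; - some $s\in R[{\sim}q]$ has $+\partial^*A(s)\subseteq E$ and not $r>s$. $\pm\delta$ are defined exactly as $\pm\partial$, with every $\partial$ replaced by $\delta$, with two exceptions. In the $+\delta$ clause, the escape for $s$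 is "some $a\in A(s)$ has $-\sigma a\in E$". In the $-\delta$ clause, the condition on $s$ is "$+\sigma A(s)\subseteq E$". $+\sigma q\in\mathcal T_D(E)$ iff either $+\Delta q\in E$, or there is $r\in R_{sd}[q]$ with $+\sigma A(r)\subseteq E$ such that every $s\in R[{\sim}q]$ either has some $a\in A(s)$ with $-\delta a\in E$ or satisfies not $s>r$. $-\sigma q\in\mathcal T_D(E)$ iff $-\Delta q\in E$ and every $r\in R_{sd}[q]$ either has some $a\in A(r)$ with $-\sigma a\in E$, or there is $s\in R[{\sim}q]$ with $+\delta A(s)\subseteq E$ and $s>r$. $\pm\delta^*$ are defined exactly as $\pm\partial^*$, with every $\partial^*$ replaced by $\delta^*$, with two exceptions. In the $+\delta^*$ clause, the escape for $s$ is "some $a\in A(s)$ has $-\sigma^*a\in E$". In the $-\delta^*$ clause, the condition on $s$ is "$+\sigma^*A(s)\subseteq E$". $\pm\sigma^*$ are defined exactly as $\pm\sigma$, with $\sigma,\delta$ replaced by $\sigma^*,\delta^*$ respectively. The logic $\mathbf{DL}(d)$, for $d\in\{\partial,\partial^*,\delta,\delta^*\}$, has principal tag $d$ and uses these inference rules. Addition. For theories $D=(F,R,>)$ and $A=(F',R',>')$ with $\Lambda(D)\cap\Lambda(A)=\emptyset$, define $D+A=(F\cup F',R\cup R',>\cup>')$. Given theories $D_1,D_2$, an addition $A$ is modular if - $\Sigma(A)\cap\Sigma(D_2)\subseteq\Sigma(D_1)$, - $\Lambda(D_1)\cap\Lambda(A)=\emptyset$, and - $\Lambda(D_2)\cap\Lambda(A)=\emptyset$.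 Simulation. Let $L_1$ and $L_2$ be logics with principal tags $d_1$ and $d_2$, and let $C$ be a class of theories. A theory $D_1$ in $L_1$ is simulated by $D_2$ in $L_2$ with respect to $C$ if, for every $A\in C$ modular with respect to $D_1,D_2$ and every literal $q\in\Sigma(D_1+A)$: - $D_1+A\vdash +d_1q$ iff $D_2+A\vdash+d_2q$, and - $D_1+A\vdash -d_1q$ iff $D_2+A\vdash-d_2q$. $L_1$ can be simulated by $L_2$ with respect to $C$ if every theory in $L_1$ is simulated by some theory in $L_2$. "Addition of facts" means $C$ is the class of theories $(F,\emptyset,\emptyset)$; "addition of rules" means $C$ is the class of theories $(\emptyset,R,\emptyset)$. *)

theory Defs
  imports Main
begin

datatype 'a lit = Pos 'a | Neg 'a

fun compl :: "'a lit \<Rightarrow> 'a lit" where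
  "compl (Pos p) = Neg p"
| "compl (Neg p) = Pos p"

datatype rkind = Strict | Defeasible | Defeater

datatype ('a, 'l) rule =
  Rule (rlabel: 'l) (body: "'a lit set") (head: "'a lit") (kind: rkind)

datatype ('a, 'l) dtheory =
  DTheory (facts: "'a lit set") (rules: "('a, 'l) rule set") (sup: "('l \<times> 'l) set")

definition wf_theory :: "('a, 'l) dtheory \<Rightarrow> bool" where
  "wf_theory D \<longleftrightarrow> finite (rules D) \<and> (\<forall>r\<in>rules D. finite (body r))
     \<and> inj_on rlabel (rules D) \<and> acyclic (sup D)"

definition Rs :: "('a, 'l) dtheory \<Rightarrow> 'a lit \<Rightarrow> ('a, 'l) rule set" where
  "Rs D q = {r \<in> rules D. kind r = Strict \<and> head r = q}"

definition Rsd :: "('a, 'l) dtheory \<Rightarrow> 'a lit \<Rightarrow> ('a, 'l) rule set" where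
  "Rsd D q = {r \<in> rules D. kind r \<noteq> Defeater \<and> head r = q}"

definition Rall :: "('a, 'l) dtheory \<Rightarrow> 'a lit \<Rightarrow> ('a, 'l) rule set" where
  "Rall D q = {r \<in> rules D. head r = q}"

definition gt :: "('a, 'l) dtheory \<Rightarrow> ('a, 'l) rule \<Rightarrow> ('a, 'l) rule \<Rightarrow> bool" where
  "gt D t s \<longleftrightarrow> (rlabel t, rlabel s) \<in> sup D"

definition Sigma_th :: "('a, 'l) dtheory \<Rightarrow> 'a lit set" where
  "Sigma_th D = facts D \<union> head ` rules D \<union> \<Union> (body ` rules D)"

definition Lambda_th :: "('a, 'l) dtheory \<Rightarrow> 'l set" where
  "Lambda_th D = rlabel ` rules D \<union> Field (sup D)"

datatype tag = Delta | Partial | PartialS | Dl | Sg | DlS | SgS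

datatype 'a concl = Plus tag "'a lit" | Minus tag "'a lit"

definition allP :: "'a concl set \<Rightarrow> tag \<Rightarrow> 'a lit set \<Rightarrow> bool" where
  "allP E d B \<longleftrightarrow> (\<forall>a\<in>B. Plus d a \<in> E)"

definition someM :: "'a concl set \<Rightarrow> tag \<Rightarrow> 'a lit set \<Rightarrow> bool" where
  "someM E d B \<longleftrightarrow> (\<exists>a\<in>B. Minus d a \<in> E)"

definition plus_amb :: "('a, 'l) dtheory \<Rightarrow> 'a concl set \<Rightarrow> tag \<Rightarrow> tag \<Rightarrow> 'a lit \<Rightarrow> bool" where
  "plus_amb D E d e q \<longleftrightarrow> Plus Delta q \<in> E \<or>
     ((\<exists>r\<in>Rsd D q. allP E d (body r)) \<and> Minus Delta (compl q) \<in> E \<and>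
      (\<forall>s\<in>Rall D (compl q). someM E e (body s) \<or>
          (\<exists>t\<in>Rsd D q. allP E d (body t) \<and> gt D t s)))"

definition minus_amb :: "('a, 'l) dtheory \<Rightarrow> 'a concl set \<Rightarrow> tag \<Rightarrow> tag \<Rightarrow> 'a lit \<Rightarrow> bool" where
  "minus_amb D E d e q \<longleftrightarrow> Minus Delta q \<in> E \<and>
     ((\<forall>r\<in>Rsd D q. someM E d (body r)) \<or> Plus Delta (compl q) \<in> E \<or>
      (\<exists>s\<in>Rall D (compl q). allP E e (body s) \<and>
          (\<forall>t\<in>Rsd D q. someM E d (body t) \<or> \<not> gt D t s)))"

definition plus_ind :: "('a, 'l) dtheory \<Rightarrow> 'a concl set \<Rightarrow> tag \<Rightarrow> tag \<Rightarrow> 'a lit \<Rightarrow> bool" where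
  "plus_ind D E d e q \<longleftrightarrow> Plus Delta q \<in> E \<or>
     (\<exists>r\<in>Rsd D q. allP E d (body r) \<and> Minus Delta (compl q) \<in> E \<and>
      (\<forall>s\<in>Rall D (compl q). someM E e (body s) \<or> gt D r s))"

definition minus_ind :: "('a, 'l) dtheory \<Rightarrow> 'a concl set \<Rightarrow> tag \<Rightarrow> tag \<Rightarrow> 'a lit \<Rightarrow> bool" where
  "minus_ind D E d e q \<longleftrightarrow> Minus Delta q \<in> E \<and>
     (\<forall>r\<in>Rsd D q. someM E d (body r) \<or> Plus Delta (compl q) \<in> E \<or>
      (\<exists>s\<in>Rall D (compl q). allP E e (body s) \<and> \<not> gt D r s))"

definition plus_sup :: "('a, 'l) dtheory \<Rightarrow> 'a concl set \<Rightarrow> tag \<Rightarrow> tag \<Rightarrow> 'a lit \<Rightarrow> bool" where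
  "plus_sup D E sg dl q \<longleftrightarrow> Plus Delta q \<in> E \<or>
     (\<exists>r\<in>Rsd D q. allP E sg (body r) \<and>
      (\<forall>s\<in>Rall D (compl q). someM E dl (body s) \<or> \<not> gt D s r))"

definition minus_sup :: "('a, 'l) dtheory \<Rightarrow> 'a concl set \<Rightarrow> tag \<Rightarrow> tag \<Rightarrow> 'a lit \<Rightarrow> bool" where
  "minus_sup D E sg dl q \<longleftrightarrow> Minus Delta q \<in> E \<and>
     (\<forall>r\<in>Rsd D q. someM E sg (body r) \<or>
      (\<exists>s\<in>Rall D (compl q). allP E dl (body s) \<and> gt D s r))"

fun step :: "('a, 'l) dtheory \<Rightarrow> 'a concl set \<Rightarrow> 'a concl \<Rightarrow> bool" where
  "step D E (Plus Delta q) \<longleftrightarrow> q \<in> facts D \<or> (\<exists>r\<in>Rs D q. allP E Delta (body r))"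
| "step D E (Minus Delta q) \<longleftrightarrow> q \<notin> facts D \<and> (\<forall>r\<in>Rs D q. someM E Delta (body r))"
| "step D E (Plus Partial q) \<longleftrightarrow> plus_amb D E Partial Partial q"
| "step D E (Minus Partial q) \<longleftrightarrow> minus_amb D E Partial Partial q"
| "step D E (Plus PartialS q) \<longleftrightarrow> plus_ind D E PartialS PartialS q"
| "step D E (Minus PartialS q) \<longleftrightarrow> minus_ind D E PartialS PartialS q"
| "step D E (Plus Dl q) \<longleftrightarrow> plus_amb D E Dl Sg q"
| "step D E (Minus Dl q) \<longleftrightarrow> minus_amb D E Dl Sg q"
| "step D E (Plus Sg q) \<longleftrightarrow> plus_sup D E Sg Dl q"
| "step D E (Minus Sg q) \<longleftrightarrow> minus_sup D E Sg Dl q"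
| "step D E (Plus DlS q) \<longleftrightarrow> plus_ind D E DlS SgS q"
| "step D E (Minus DlS q) \<longleftrightarrow> minus_ind D E DlS SgS q"
| "step D E (Plus SgS q) \<longleftrightarrow> plus_sup D E SgS DlS q"
| "step D E (Minus SgS q) \<longleftrightarrow> minus_sup D E SgS DlS q"

definition T_op :: "('a, 'l) dtheory \<Rightarrow> 'a concl set \<Rightarrow> 'a concl set" where
  "T_op D E = {c. step D E c}"

definition proves :: "('a, 'l) dtheory \<Rightarrow> 'a concl \<Rightarrow> bool" where
  "proves D c \<longleftrightarrow> c \<in> (\<Union>n. (T_op D ^^ n) {})"

definition add_th :: "('a, 'l) dtheory \<Rightarrow> ('a, 'l) dtheory \<Rightarrow> ('a, 'l) dtheory" where
  "add_th D A = DTheory (facts D \<union> facts A) (rules D \<union> rules A) (sup D \<union> sup A)"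

definition modular :: "('a, 'l) dtheory \<Rightarrow> ('a, 'l) dtheory \<Rightarrow> ('a, 'l) dtheory \<Rightarrow> bool" where
  "modular D1 D2 A \<longleftrightarrow> Sigma_th A \<inter> Sigma_th D2 \<subseteq> Sigma_th D1
     \<and> Lambda_th D1 \<inter> Lambda_th A = {} \<and> Lambda_th D2 \<inter> Lambda_th A = {}"

definition simulated_wrt ::
  "(('a, 'l) dtheory \<Rightarrow> bool) \<Rightarrow> tag \<Rightarrow> ('a, 'l) dtheory \<Rightarrow> tag \<Rightarrow> ('a, 'l) dtheory \<Rightarrow> bool" where
  "simulated_wrt C d1 D1 d2 D2 \<longleftrightarrow>
     (\<forall>A. C A \<and> modular D1 D2 A \<longrightarrow>
       (\<forall>q\<in>Sigma_th (add_th D1 A).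
          (proves (add_th D1 A) (Plus d1 q) \<longleftrightarrow> proves (add_th D2 A) (Plus d2 q)) \<and>
          (proves (add_th D1 A) (Minus d1 q) \<longleftrightarrow> proves (add_th D2 A) (Minus d2 q))))"

definition facts_only :: "('a, 'l) dtheory \<Rightarrow> bool" where
  "facts_only A \<longleftrightarrow> rules A = {} \<and> sup A = {}"

end

theory Submission
  imports Defs
begin

text \<open>Since the facts of \<open>D1\<close> may exhaust the language, no fresh propositions can be assumed, and the
  simulation uses the literals of \<open>D1\<close> only. Write a state as a pair (P, N) of the literals
  concluded \<open>+d\<close> and \<open>-d\<close>. Eliminating the tags \<open>\<plusminus>\<sigma>\<close> by an inner least fixed point, \<open>D1\<close> accepts or
  rejects q according to a monotone condition on states, and no accepting state of q is compatible
  with a rejecting one.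

  The simulating theory has, for each q and each finite set Q of literals that contains the body of
  a rule for q, a rule with body Q and head q. Against q stand defeaters with body Y, one for each
  state (Y, Z) that is incompatible with all accepting states of q and either rejects q or has
  q in Z. The rule Q beats the defeater (Y, Z) iff Q meets Z. Thus an accepting state overcomes all
  defeaters, a rejecting state supplies a defeater of its own, and in any other state the defeaters
  with q in Z prevent q from being proved; they can be used to refute q only when \<open>-d q\<close>
  is known already, which adds nothing to the least fixed point. In a given state the largest
  applicable set Q beats everything that smaller ones beat, so it makes no difference whether defeat
  is by teams or by single rules.\<close>

section \<open>Conclusions as a fixed point\<close>

definition body_lits :: "('a, 'l) dtheory \<Rightarrow> 'a lit set" where
  "body_lits D = \<Union> (body ` rules D)"

fun concl_lit :: "'a concl \<Rightarrow> 'a lit" where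
  "concl_lit (Plus d q) = q"
| "concl_lit (Minus d q) = q"

definition stage :: "('a, 'l) dtheory \<Rightarrow> nat \<Rightarrow> 'a concl set" where
  "stage D n = (T_op D ^^ n) {}"

lemma stage_0 [simp]: "stage D 0 = {}"
  by (simp add: stage_def)

lemma stage_Suc: "stage D (Suc n) = {c. step D (stage D n) c}"
  by (simp add: stage_def T_op_def)

lemma proves_stage: "proves D c \<longleftrightarrow> (\<exists>n. c \<in> stage D n)"
  by (simp add: proves_def stage_def)

lemma in_body_lits:
  assumes "a \<in> body r" and "r \<in> Rsd D q \<or> r \<in> Rall D q \<or> r \<in> Rs D q"
  shows "a \<in> body_lits D"
  using assms by (auto simp: body_lits_def Rsd_def Rall_def Rs_def)

text \<open>Each clause consults only body literals, the concluded literal and its complement. This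
  locality gives monotonicity and, for finitely many finite bodies, continuity.\<close>

lemma step_mono_local:
  assumes "step D E c"
    and sub: "\<And>c'. c' \<in> E \<Longrightarrow> concl_lit c' \<in> body_lits D \<union> {concl_lit c, compl (concl_lit c)} \<Longrightarrow> c' \<in> E'"
  shows "step D E' c"
proof -
  have P: "allP E d (body r) \<Longrightarrow> allP E' d (body r)"
    if "r \<in> Rsd D q \<or> r \<in> Rall D q \<or> r \<in> Rs D q" for d q r
    using sub in_body_lits[OF _ that] by (auto simp: allP_def)
  have M: "someM E d (body r) \<Longrightarrow> someM E' d (body r)"
    if "r \<in> Rsd D q \<or> r \<in> Rall D q \<or> r \<in> Rs D q" for d q r
    using sub in_body_lits[OF _ that] by (fastforce simp: someM_def)
  have L: "Plus d a \<in> E'" if "Plus d a \<in> E" "a = concl_lit c \<or> a = compl (concl_lit c)" for d a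
    using sub that by auto
  have L': "Minus d a \<in> E'" if "Minus d a \<in> E" "a = concl_lit c \<or> a = compl (concl_lit c)" for d a
    using sub that by auto
  show ?thesis
  proof (cases c)
    case (Plus d q)
    have "Plus Delta q \<in> E \<Longrightarrow> Plus Delta q \<in> E'" "Minus Delta (compl q) \<in> E \<Longrightarrow> Minus Delta (compl q) \<in> E'"
      using Plus L L' by auto
    then show ?thesis using \<open>step D E c\<close> unfolding Plus
      by (cases d; simp add: plus_amb_def plus_ind_def plus_sup_def; meson P M)
  next
    case (Minus d q)
    have "Minus Delta q \<in> E \<Longrightarrow> Minus Delta q \<in> E'" "Plus Delta (compl q) \<in> E \<Longrightarrow> Plus Delta (compl q) \<in> E'"
      using Minus L L' by auto
    then show ?thesis using \<open>step D E c\<close> unfolding Minus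
      by (cases d; simp add: minus_amb_def minus_ind_def minus_sup_def; meson P M)
  qed
qed

lemma step_mono: "step D E c \<Longrightarrow> E \<subseteq> E' \<Longrightarrow> step D E' c"
  by (erule step_mono_local) auto

lemma stage_Suc_mono: "stage D n \<subseteq> stage D (Suc n)"
  by (induction n) (auto simp: stage_Suc intro: step_mono)

lemma stage_mono: "m \<le> n \<Longrightarrow> stage D m \<subseteq> stage D n"
  by (rule lift_Suc_mono_le[of "stage D"]) (use stage_Suc_mono in auto)

lemma finite_subset_stage:
  assumes "finite K" and "K \<subseteq> {c. proves D c}"
  shows "\<exists>n. K \<subseteq> stage D n"
  using assms
proof (induction K rule: finite_induct)
  case (insert c K)
  then obtain m n where "K \<subseteq> stage D m" "c \<in> stage D n"
    by (auto simp: proves_stage)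
  then have "insert c K \<subseteq> stage D (max m n)"
    using stage_mono[of m "max m n" D] stage_mono[of n "max m n" D] by auto
  then show ?case by blast
qed simp

text \<open>The stages reach a fixed point at \<omega> although the facts may be infinite: a step
  consults only the finite set \<open>K\<close> of conclusions, and all of \<open>K\<close> is
  present at one stage.\<close>

lemma proves_iff_step:
  assumes "wf_theory D"
  shows "proves D c \<longleftrightarrow> step D {c'. proves D c'} c"
proof
  assume "proves D c"
  then obtain n where "c \<in> stage D n" by (auto simp: proves_stage)
  then have "step D (stage D n) c"
    using stage_Suc_mono[of D n] by (auto simp: stage_Suc)
  then show "step D {c'. proves D c'} c"
    by (rule step_mono) (auto simp: proves_stage)
next
  assume *: "step D {c'. proves D c'} c"
  define L where "L = body_lits D \<union> {concl_lit c, compl (concl_lit c)}"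
  define K where "K = {c'. proves D c' \<and> concl_lit c' \<in> L}"
  have "finite L" using assms by (auto simp: L_def body_lits_def wf_theory_def)
  moreover have "finite (UNIV :: tag set)"
    by (rule finite_subset[of _ "{Delta, Partial, PartialS, Dl, Sg, DlS, SgS}"])
      (auto intro: tag.exhaust)
  moreover have "K \<subseteq> case_prod Plus ` (UNIV \<times> L) \<union> case_prod Minus ` (UNIV \<times> L)"
  proof
    fix x assume "x \<in> K"
    then show "x \<in> case_prod Plus ` (UNIV \<times> L) \<union> case_prod Minus ` (UNIV \<times> L)"
      by (cases x) (auto simp: K_def)
  qed
  ultimately have "finite K"
    by (meson finite_SigmaI finite_UnI finite_imageI finite_subset)
  then obtain n where n: "K \<subseteq> stage D n"
    using finite_subset_stage[of K D] by (auto simp: K_def)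
  have "step D (stage D n) c"
    using * by (rule step_mono_local) (use n in \<open>auto simp: K_def L_def\<close>)
  then show "proves D c"
    using stage_Suc[of D n] by (auto simp: proves_stage)
qed

section \<open>Support and refutation of a literal\<close>

text \<open>The defeasible clauses without their \<open>\<Delta>\<close> premises. \<open>P\<close>
  and \<open>V\<close> are separate because for \<delta> an attacker is discarded by -\<sigma>;
  \<open>team\<close> chooses between team and individual defeat.\<close>

definition pro :: "bool \<Rightarrow> ('a, 'l) dtheory \<Rightarrow> 'a lit set \<Rightarrow> 'a lit set \<Rightarrow> 'a lit \<Rightarrow> bool" where
  "pro team D P V q \<longleftrightarrow>
     (\<exists>r\<in>Rsd D q. body r \<subseteq> P \<and> (\<forall>s\<in>Rall D (compl q). body s \<inter> V \<noteq> {} \<or>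
        (if team then \<exists>t\<in>Rsd D q. body t \<subseteq> P \<and> gt D t s else gt D r s)))"

definition con :: "bool \<Rightarrow> ('a, 'l) dtheory \<Rightarrow> 'a lit set \<Rightarrow> 'a lit set \<Rightarrow> 'a lit \<Rightarrow> bool" where
  "con team D N W q \<longleftrightarrow>
     (\<forall>r\<in>Rsd D q. body r \<inter> N \<noteq> {} \<or> (\<exists>s\<in>Rall D (compl q). body s \<subseteq> W \<and>
        (if team then \<forall>t\<in>Rsd D q. body t \<inter> N \<noteq> {} \<or> \<not> gt D t s else \<not> gt D r s)))"

text \<open>Comparing the sets on body literals only allows any state to be cut down to the finitely
  many literals of the rules.\<close>

lemma pro_mono:
  assumes "pro tm D P V q" "P \<inter> body_lits D \<subseteq> P'" "V \<inter> body_lits D \<subseteq> V'"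
  shows "pro tm D P' V' q"
proof -
  have *: "body r \<subseteq> P \<Longrightarrow> body r \<subseteq> P'" "body r \<inter> V \<noteq> {} \<Longrightarrow> body r \<inter> V' \<noteq> {}"
    if "r \<in> Rsd D x \<or> r \<in> Rall D x" for r x
    using assms(2,3) in_body_lits[of _ r D x] that by blast+
  from assms(1) show ?thesis
    unfolding pro_def by (cases tm; simp; meson *)
qed

lemma con_mono:
  assumes "con tm D N W q" "N \<inter> body_lits D \<subseteq> N'" "W \<inter> body_lits D \<subseteq> W'"
  shows "con tm D N' W' q"
proof -
  have *: "body r \<subseteq> W \<Longrightarrow> body r \<subseteq> W'" "body r \<inter> N \<noteq> {} \<Longrightarrow> body r \<inter> N' \<noteq> {}"
    if "r \<in> Rsd D x \<or> r \<in> Rall D x" for r x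
    using assms(2,3) in_body_lits[of _ r D x] that by blast+
  from assms(1) show ?thesis
    unfolding con_def by (cases tm; simp; meson *)
qed

text \<open>If both intersections were empty, the supporting rule would escape \<open>N\<close>, so
  \<open>con\<close> would name an attacker; it escapes \<open>V\<close>, so \<open>pro\<close>
  beats it by a rule applicable in \<open>P\<close>, which escapes \<open>N\<close> as well.\<close>

lemma pro_con_conflict:
  assumes pro: "pro tm D P V q" and con: "con tm D N W q"
  shows "P \<inter> N \<noteq> {} \<or> V \<inter> W \<noteq> {}"
proof (rule ccontr)
  assume "\<not> ?thesis"
  then have disj: "\<And>r. body r \<subseteq> P \<Longrightarrow> body r \<inter> N = {}" "\<And>s. body s \<subseteq> W \<Longrightarrow> body s \<inter> V = {}"
    by auto
  obtain r where r: "r \<in> Rsd D q" "body r \<subseteq> P"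
    and beat: "\<And>s. s \<in> Rall D (compl q) \<Longrightarrow> body s \<inter> V = {} \<Longrightarrow>
      if tm then \<exists>t\<in>Rsd D q. body t \<subseteq> P \<and> gt D t s else gt D r s"
    using pro unfolding pro_def by blast
  obtain s where s: "s \<in> Rall D (compl q)" "body s \<subseteq> W"
    and unbeaten: "if tm then \<forall>t\<in>Rsd D q. body t \<inter> N \<noteq> {} \<or> \<not> gt D t s else \<not> gt D r s"
    using con r disj(1) unfolding con_def by blast
  from beat[OF s(1) disj(2)[OF s(2)]] unbeaten show False
    using disj(1) by (cases tm) auto
qed

text \<open>\<open>pro False\<close> and \<open>con True\<close> are the strongest forms,
  \<open>pro True\<close> and \<open>con False\<close> the weakest. Later the simulation delivers
  the strongest and assumes only the weakest, and so serves both kinds of defeat.\<close>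

lemma pro_team: "pro tm D P V q \<Longrightarrow> pro True D P V q"
  by (cases tm) (auto simp: pro_def)

lemma con_team: "con True D N W q \<Longrightarrow> con tm D N W q"
  by (cases tm; simp add: con_def; blast)

lemma pro_individual: "pro False D P V q \<Longrightarrow> pro tm D P V q"
  by (cases tm; simp add: pro_def; blast)

lemma con_individual: "con tm D N W q \<Longrightarrow> con False D N W q"
  by (cases tm; simp add: con_def; blast)

definition dl :: "bool \<Rightarrow> tag" where "dl tm = (if tm then Dl else DlS)"
definition sg :: "bool \<Rightarrow> tag" where "sg tm = (if tm then Sg else SgS)"
definition pt :: "bool \<Rightarrow> tag" where "pt tm = (if tm then Partial else PartialS)"

lemma allP_iff: "allP E d B \<longleftrightarrow> B \<subseteq> {a. Plus d a \<in> E}"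
  by (auto simp: allP_def)

lemma someM_iff: "someM E d B \<longleftrightarrow> B \<inter> {a. Minus d a \<in> E} \<noteq> {}"
  by (auto simp: someM_def)

lemma step_plus:
  "step D E (Plus (dl tm) q) \<longleftrightarrow> Plus Delta q \<in> E \<or> Minus Delta (compl q) \<in> E \<and>
     pro tm D {a. Plus (dl tm) a \<in> E} {a. Minus (sg tm) a \<in> E} q"
  "step D E (Plus (pt tm) q) \<longleftrightarrow> Plus Delta q \<in> E \<or> Minus Delta (compl q) \<in> E \<and>
     pro tm D {a. Plus (pt tm) a \<in> E} {a. Minus (pt tm) a \<in> E} q"
  by (cases tm; simp add: dl_def sg_def pt_def plus_amb_def plus_ind_def allP_iff someM_iff pro_def; blast)+

lemma step_minus:
  "step D E (Minus (dl tm) q) \<longleftrightarrow> Minus Delta q \<in> E \<and> (Plus Delta (compl q) \<in> E \<or>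
     con tm D {a. Minus (dl tm) a \<in> E} {a. Plus (sg tm) a \<in> E} q)"
  "step D E (Minus (pt tm) q) \<longleftrightarrow> Minus Delta q \<in> E \<and> (Plus Delta (compl q) \<in> E \<or>
     con tm D {a. Minus (pt tm) a \<in> E} {a. Plus (pt tm) a \<in> E} q)"
  by (cases tm; simp add: dl_def sg_def pt_def minus_amb_def minus_ind_def allP_iff someM_iff con_def; blast)+

lemma step_sg:
  "step D E (Plus (sg tm) q) \<longleftrightarrow> Plus Delta q \<in> E \<or>
     (\<exists>r\<in>Rsd D q. body r \<subseteq> {a. Plus (sg tm) a \<in> E} \<and>
        (\<forall>s\<in>Rall D (compl q). body s \<inter> {a. Minus (dl tm) a \<in> E} \<noteq> {} \<or> \<not> gt D s r))"
  "step D E (Minus (sg tm) q) \<longleftrightarrow> Minus Delta q \<in> E \<and>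
     (\<forall>r\<in>Rsd D q. body r \<inter> {a. Minus (sg tm) a \<in> E} \<noteq> {} \<or>
        (\<exists>s\<in>Rall D (compl q). body s \<subseteq> {a. Plus (dl tm) a \<in> E} \<and> gt D s r))"
  by (cases tm; simp add: dl_def sg_def plus_sup_def minus_sup_def allP_iff someM_iff)+

section \<open>Inclusions between defeasible and support conclusions\<close>

lemma finite_maximal:
  assumes "finite A" "A \<noteq> {}" "acyclic R"
  shows "\<exists>m\<in>A. \<forall>x\<in>A. (f x, f m) \<notin> R\<^sup>+"
  using assms(1,2)
proof (induction A rule: finite_ne_induct)
  case (singleton x)
  then show ?case using assms(3) by (simp add: acyclic_def)
next
  case (insert x A)
  then obtain m where m: "m \<in> A" "\<forall>y\<in>A. (f y, f m) \<notin> R\<^sup>+" by blast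
  show ?case
  proof (cases "(f x, f m) \<in> R\<^sup>+")
    case True
    then have "\<forall>y\<in>insert x A. (f y, f x) \<notin> R\<^sup>+"
      using m assms(3) by (auto simp: acyclic_def dest: trancl_trans)
    then show ?thesis by blast
  next
    case False
    then show ?thesis using m by blast
  qed
qed

text \<open>Superiority is acyclic but need not be transitive; the closure is taken because the
  arguments below climb two steps at a time.\<close>

lemma maximal_rule:
  assumes "wf_theory D" "r0 \<in> rules D" "Q r0"
  shows "\<exists>m\<in>rules D. Q m \<and> (\<forall>x\<in>rules D. Q x \<longrightarrow> (rlabel x, rlabel m) \<notin> (sup D)\<^sup>+)"
  using finite_maximal[of "{r \<in> rules D. Q r}" "sup D" rlabel] assms
  by (auto simp: wf_theory_def)

lemma compl_compl [simp]: "compl (compl q) = q"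
  by (cases q) auto

lemma compl_inject [simp]: "compl p = compl q \<longleftrightarrow> p = q"
  by (metis compl_compl)

text \<open>Take a maximal applicable rule for \<open>q\<close>. An undiscarded attacker beating it
  would itself be beaten by an applicable rule for \<open>q\<close>, which lies two steps above the
  maximal one.\<close>

lemma pro_supported:
  assumes "wf_theory D" "pro tm D P V q"
  shows "\<exists>r\<in>Rsd D q. body r \<subseteq> P \<and> (\<forall>s\<in>Rall D (compl q). body s \<inter> V \<noteq> {} \<or> \<not> gt D s r)"
proof -
  have pro: "pro True D P V q" using assms(2) by (rule pro_team)
  then obtain r0 where "r0 \<in> Rsd D q" "body r0 \<subseteq> P" by (auto simp: pro_def)
  then obtain r where r: "r \<in> Rsd D q" "body r \<subseteq> P"
    and max: "\<And>x. x \<in> Rsd D q \<Longrightarrow> body x \<subseteq> P \<Longrightarrow> (rlabel x, rlabel r) \<notin> (sup D)\<^sup>+"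
    using maximal_rule[OF assms(1), of r0 "\<lambda>x. x \<in> Rsd D q \<and> body x \<subseteq> P"]
    by (auto simp: Rsd_def)
  have "body s \<inter> V \<noteq> {} \<or> \<not> gt D s r" if s: "s \<in> Rall D (compl q)" for s
  proof (rule ccontr)
    assume neg: "\<not> (body s \<inter> V \<noteq> {} \<or> \<not> gt D s r)"
    then obtain t where "t \<in> Rsd D q" "body t \<subseteq> P" "gt D t s"
      using pro s neg by (auto simp: pro_def)
    with neg max show False by (meson gt_def trancl.intros)
  qed
  with r show ?thesis by blast
qed

text \<open>Dually, take a maximal applicable attacker: an undiscarded rule beating it would be
  beaten by an attacker still higher up.\<close>

lemma con_unsupported:
  assumes "wf_theory D"
    and *: "\<forall>r\<in>Rsd D q. body r \<inter> N \<noteq> {} \<or> (\<exists>s\<in>Rall D (compl q). body s \<subseteq> W \<and> gt D s r)"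
  shows "con tm D N W q"
proof (rule con_team, cases "\<forall>r\<in>Rsd D q. body r \<inter> N \<noteq> {}")
  case False
  with * obtain s0 where "s0 \<in> Rall D (compl q)" "body s0 \<subseteq> W" by blast
  then obtain s where s: "s \<in> Rall D (compl q)" "body s \<subseteq> W"
    and max: "\<And>x. x \<in> Rall D (compl q) \<Longrightarrow> body x \<subseteq> W \<Longrightarrow> (rlabel x, rlabel s) \<notin> (sup D)\<^sup>+"
    using maximal_rule[OF assms(1), of s0 "\<lambda>x. x \<in> Rall D (compl q) \<and> body x \<subseteq> W"]
    by (auto simp: Rall_def)
  have "body t \<inter> N \<noteq> {} \<or> \<not> gt D t s" if t: "t \<in> Rsd D q" for t
  proof (rule ccontr)
    assume neg: "\<not> (body t \<inter> N \<noteq> {} \<or> \<not> gt D t s)"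
    then obtain x where "x \<in> Rall D (compl q)" "body x \<subseteq> W" "gt D x t"
      using * t neg by blast
    with neg max show False by (meson gt_def trancl.intros)
  qed
  with s show "con True D N W q" by (auto simp: con_def)
qed (simp add: con_def)

definition incl :: "bool \<Rightarrow> 'a concl set \<Rightarrow> bool" where
  "incl tm E \<longleftrightarrow> (\<forall>q. Plus (dl tm) q \<in> E \<longrightarrow> Plus (sg tm) q \<in> E)
     \<and> (\<forall>q. Minus (sg tm) q \<in> E \<longrightarrow> Minus (dl tm) q \<in> E)"

lemma incl_step:
  assumes "wf_theory D" "incl tm E"
  shows "step D E (Plus (dl tm) q) \<Longrightarrow> step D E (Plus (sg tm) q)"
    and "step D E (Minus (sg tm) q) \<Longrightarrow> step D E (Minus (dl tm) q)"
proof -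
  have P: "{a. Plus (dl tm) a \<in> E} \<subseteq> {a. Plus (sg tm) a \<in> E}"
    and M: "{a. Minus (sg tm) a \<in> E} \<subseteq> {a. Minus (dl tm) a \<in> E}"
    using assms(2) by (auto simp: incl_def)
  show "step D E (Plus (sg tm) q)" if "step D E (Plus (dl tm) q)"
  proof (cases "Plus Delta q \<in> E")
    case False
    with that have "pro tm D {a. Plus (sg tm) a \<in> E} {a. Minus (dl tm) a \<in> E} q"
      using P M by (auto simp: step_plus intro: pro_mono)
    then show ?thesis
      using pro_supported[OF assms(1)] by (auto simp: step_sg)
  qed (simp add: step_sg)
  show "step D E (Minus (dl tm) q)" if "step D E (Minus (sg tm) q)"
  proof -
    have "con tm D {a. Minus (sg tm) a \<in> E} {a. Plus (dl tm) a \<in> E} q"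
      using that by (intro con_unsupported[OF assms(1)]) (simp add: step_sg)
    then have "con tm D {a. Minus (dl tm) a \<in> E} {a. Plus (sg tm) a \<in> E} q"
      by (rule con_mono) (use P M in auto)
    then show ?thesis using that by (simp add: step_minus step_sg)
  qed
qed

text \<open>The inclusions hold at each single stage, so that a -\<sigma> step can later be traded
  for a -\<delta> step from the same stage.\<close>

lemma incl_stage:
  assumes "wf_theory D"
  shows "incl tm (stage D n)"
proof (induction n)
  case (Suc n)
  then show ?case
    using incl_step[OF assms Suc] by (simp add: incl_def stage_Suc)
qed (simp add: incl_def)

section \<open>Eliminating the support tags\<close>

text \<open>For a fixed set P of literals tagged \<open>+\<delta>\<close> and N tagged \<open>-\<delta>\<close>, the tags \<open>\<plusminus>\<sigma>\<close> are a
  least fixed point that no longer mentions \<open>\<Delta>\<close>: the premise \<open>+\<Delta> q\<close> may be weakened to \<open>+\<delta> q\<close>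
  since \<open>+\<delta>\<close> implies \<open>+\<sigma>\<close>, and \<open>-\<Delta> q\<close> strengthened to \<open>-\<delta> q\<close> since \<open>-\<sigma>\<close> implies \<open>-\<delta>\<close>, stage
  by stage.\<close>

inductive_set splus :: "('a, 'l) dtheory \<Rightarrow> 'a lit set \<Rightarrow> 'a lit set \<Rightarrow> 'a lit set" for D P N where
  base: "q \<in> P \<Longrightarrow> q \<in> splus D P N"
| rule: "r \<in> Rsd D q \<Longrightarrow> \<forall>a\<in>body r. a \<in> splus D P N \<Longrightarrow>
    \<forall>s\<in>Rall D (compl q). body s \<inter> N \<noteq> {} \<or> \<not> gt D s r \<Longrightarrow> q \<in> splus D P N"

inductive_set sminus :: "('a, 'l) dtheory \<Rightarrow> 'a lit set \<Rightarrow> 'a lit set \<Rightarrow> 'a lit set" for D P N where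
  rule: "q \<in> N \<Longrightarrow> \<forall>r\<in>Rsd D q. (\<exists>a\<in>body r. a \<in> sminus D P N) \<or>
    (\<exists>s\<in>Rall D (compl q). body s \<subseteq> P \<and> gt D s r) \<Longrightarrow> q \<in> sminus D P N"

text \<open>Only body literals of \<open>P\<close> are known to lie in \<open>P'\<close>, so the
  base case needs \<open>a\<close> to be one; the premises of a rule always are.\<close>

lemma splus_mono:
  assumes "a \<in> splus D P N" "a \<in> body_lits D" "P \<inter> body_lits D \<subseteq> P'" "N \<inter> body_lits D \<subseteq> N'"
  shows "a \<in> splus D P' N'"
  using assms(1,2)
proof (induction rule: splus.induct)
  case (base q)
  then show ?case using assms(3) by (auto intro: splus.base)
next
  case (rule r q)
  show ?case
  proof (rule splus.rule[OF rule(1)])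
    show "\<forall>a\<in>body r. a \<in> splus D P' N'"
      using rule in_body_lits by blast
    show "\<forall>s\<in>Rall D (compl q). body s \<inter> N' \<noteq> {} \<or> \<not> gt D s r"
      using rule.hyps assms(4) in_body_lits by blast
  qed
qed

lemma sminus_mono:
  assumes "a \<in> sminus D P N" "a \<in> body_lits D" "P \<inter> body_lits D \<subseteq> P'" "N \<inter> body_lits D \<subseteq> N'"
  shows "a \<in> sminus D P' N'"
  using assms(1,2)
proof (induction rule: sminus.induct)
  case (rule q)
  show ?case
  proof (rule sminus.rule)
    show "q \<in> N'" using rule assms(4) by blast
    show "\<forall>r\<in>Rsd D q. (\<exists>a\<in>body r. a \<in> sminus D P' N') \<or>
        (\<exists>s\<in>Rall D (compl q). body s \<subseteq> P' \<and> gt D s r)"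
    proof
      fix r assume r: "r \<in> Rsd D q"
      consider a where "a \<in> body r" "a \<in> body_lits D \<Longrightarrow> a \<in> sminus D P' N'"
        | s where "s \<in> Rall D (compl q)" "body s \<subseteq> P" "gt D s r"
        using rule(2) r by blast
      then show "(\<exists>a\<in>body r. a \<in> sminus D P' N') \<or>
          (\<exists>s\<in>Rall D (compl q). body s \<subseteq> P' \<and> gt D s r)"
      proof cases
        case 1
        then show ?thesis using in_body_lits r by blast
      next
        case 2
        then have "body s \<subseteq> P'" using in_body_lits assms(3) by blast
        with 2 show ?thesis by blast
      qed
    qed
  qed
qed

lemma sminus_subset: "sminus D P N \<subseteq> N"
  by (auto elim: sminus.cases)

text \<open>In the rule case, the induction hypothesis keeps the body out of \<open>sminus\<close>,
  so an attacker with body inside \<open>P'\<close> would have to beat the rule; that body meets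
  \<open>N\<close>, contrary to disjointness.\<close>

lemma splus_sminus_conflict:
  assumes "a \<in> splus D P N" "P \<inter> N' = {}" "P' \<inter> N = {}"
  shows "a \<notin> sminus D P' N'"
  using assms(1)
proof (induction rule: splus.induct)
  case (base q)
  then show ?case using assms(2) sminus_subset by fastforce
next
  case (rule r q)
  show ?case
  proof
    assume "q \<in> sminus D P' N'"
    then show False
      by (cases rule: sminus.cases) (use rule assms(3) in blast)
  qed
qed

definition accepts :: "bool \<Rightarrow> ('a, 'l) dtheory \<Rightarrow> 'a lit set \<Rightarrow> 'a lit set \<Rightarrow> 'a lit \<Rightarrow> bool" where
  "accepts tm D P N q \<longleftrightarrow> pro tm D P (sminus D P N) q"

definition rejects :: "bool \<Rightarrow> ('a, 'l) dtheory \<Rightarrow> 'a lit set \<Rightarrow> 'a lit set \<Rightarrow> 'a lit \<Rightarrow> bool" where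
  "rejects tm D P N q \<longleftrightarrow> con tm D N (splus D P N) q"

lemma accepts_mono:
  "accepts tm D P N q \<Longrightarrow> P \<inter> body_lits D \<subseteq> P' \<Longrightarrow> N \<inter> body_lits D \<subseteq> N' \<Longrightarrow> accepts tm D P' N' q"
  unfolding accepts_def using sminus_mono by (elim pro_mono) blast+

lemma rejects_mono:
  "rejects tm D P N q \<Longrightarrow> P \<inter> body_lits D \<subseteq> P' \<Longrightarrow> N \<inter> body_lits D \<subseteq> N' \<Longrightarrow> rejects tm D P' N' q"
  unfolding rejects_def using splus_mono by (elim con_mono) blast+

lemma accepts_rejects_conflict:
  "accepts tm D P N q \<Longrightarrow> rejects tm D P' N' q \<Longrightarrow> P \<inter> N' \<noteq> {} \<or> N \<inter> P' \<noteq> {}"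
  unfolding accepts_def rejects_def
  using pro_con_conflict[of tm D P "sminus D P N" q N' "splus D P' N'"] splus_sminus_conflict
  by blast

text \<open>This bound and the next make the rules \<open>Pro (compl q) Q'\<close> harmless as
  attackers: an accepting state beats or discards them all, and an unbeaten one refutes only what is
  rejected anyway.\<close>

lemma accepts_pro: "accepts tm D P N q \<Longrightarrow> pro True D P N q"
  unfolding accepts_def using sminus_subset[of D P N] by (blast intro: pro_team pro_mono)

lemma con_rejects: "con True D N P q \<Longrightarrow> rejects tm D P N q"
  unfolding rejects_def by (rule con_team, erule con_mono) (auto intro: splus.base)

section \<open>The simulating theory\<close>

definition rule_lits :: "('a, 'l) dtheory \<Rightarrow> 'a lit set" where
  "rule_lits D = body_lits D \<union> head ` rules D"

text \<open>\<open>Pro q Q\<close> indexes the rule with body Q for q, \<open>Con q Y Z\<close> the defeater with body Y against q.\<close>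

datatype 'a idx = Pro "'a lit" "'a lit set" | Con "'a lit" "'a lit set" "'a lit set"

definition supporters :: "('a, 'l) dtheory \<Rightarrow> 'a lit \<Rightarrow> 'a lit set \<Rightarrow> ('a, 'l) rule set" where
  "supporters D q Q = {r \<in> Rsd D q. body r \<subseteq> Q}"

definition blocks :: "bool \<Rightarrow> ('a, 'l) dtheory \<Rightarrow> 'a lit \<Rightarrow> 'a lit set \<Rightarrow> 'a lit set \<Rightarrow> bool" where
  "blocks tm D q Y Z \<longleftrightarrow> (q \<in> Z \<or> rejects tm D Y Z q)
     \<and> (\<forall>P N. accepts tm D P N q \<longrightarrow> P \<inter> Z \<noteq> {} \<or> N \<inter> Y \<noteq> {})"

fun is_index :: "bool \<Rightarrow> ('a, 'l) dtheory \<Rightarrow> 'a idx \<Rightarrow> bool" where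
  "is_index tm D (Pro q Q) \<longleftrightarrow> q \<in> rule_lits D \<and> Q \<subseteq> rule_lits D \<and> supporters D q Q \<noteq> {}"
| "is_index tm D (Con q Y Z) \<longleftrightarrow> q \<in> rule_lits D \<and> Y \<subseteq> rule_lits D \<and> Z \<subseteq> rule_lits D
     \<and> blocks tm D q Y Z"

text \<open>Between opposing \<open>Pro\<close> rules, superiority is team defeat lifted to the sets
  of rules of \<open>D\<close> that they stand for.\<close>

fun beats :: "('a, 'l) dtheory \<Rightarrow> 'a idx \<Rightarrow> 'a idx \<Rightarrow> bool" where
  "beats D (Pro q Q) (Pro q' Q') \<longleftrightarrow> q' = compl q
     \<and> (\<forall>u\<in>supporters D q' Q'. \<exists>t\<in>supporters D q Q. gt D t u)"
| "beats D (Pro q Q) (Con q' Y Z) \<longleftrightarrow> q' = q \<and> Q \<inter> Z \<noteq> {}"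
| "beats D (Con q Y Z) i \<longleftrightarrow> False"

text \<open>Strictness is kept exactly for the bodies of strict rules of \<open>D\<close>, so that
  both theories agree on \<open>\<Delta>\<close>.\<close>

fun rule_of :: "('a, 'l) dtheory \<Rightarrow> ('a idx \<Rightarrow> 'l) \<Rightarrow> 'a idx \<Rightarrow> ('a, 'l) rule" where
  "rule_of D l (Pro q Q) = Rule (l (Pro q Q)) Q q (if Q \<in> body ` Rs D q then Strict else Defeasible)"
| "rule_of D l (Con q Y Z) = Rule (l (Con q Y Z)) Y (compl q) Defeater"

definition sim :: "bool \<Rightarrow> ('a idx \<Rightarrow> 'l) \<Rightarrow> ('a, 'l) dtheory \<Rightarrow> ('a, 'l) dtheory" where
  "sim tm l D = DTheory (facts D) (rule_of D l ` Collect (is_index tm D))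
     {(l i, l j) | i j. is_index tm D i \<and> is_index tm D j \<and> beats D i j}"

lemma rule_of_sel [simp]:
  "rlabel (rule_of D l i) = l i"
  "body (rule_of D l (Pro q Q)) = Q"
  "body (rule_of D l (Con q Y Z)) = Y"
  "head (rule_of D l (Pro q Q)) = q"
  "head (rule_of D l (Con q Y Z)) = compl q"
  "kind (rule_of D l (Pro q Q)) = (if Q \<in> body ` Rs D q then Strict else Defeasible)"
  "kind (rule_of D l (Con q Y Z)) = Defeater"
  by (cases i) auto

declare rule_of.simps [simp del]

lemma body_subset_rule_lits: "r \<in> Rsd D q \<or> r \<in> Rall D q \<or> r \<in> Rs D q \<Longrightarrow> body r \<subseteq> rule_lits D"
  using in_body_lits unfolding rule_lits_def by blast

lemma head_in_rule_lits: "r \<in> Rsd D q \<Longrightarrow> q \<in> rule_lits D"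
  by (auto simp: rule_lits_def Rsd_def)

lemma finite_rule_lits: "wf_theory D \<Longrightarrow> finite (rule_lits D)"
  by (auto simp: wf_theory_def rule_lits_def body_lits_def)

lemma finite_indices:
  assumes "wf_theory D"
  shows "finite (Collect (is_index tm D))"
proof (rule finite_subset)
  let ?X = "rule_lits D"
  show "Collect (is_index tm D) \<subseteq> (\<lambda>(q, Q). Pro q Q) ` (?X \<times> Pow ?X)
      \<union> (\<lambda>(q, Y, Z). Con q Y Z) ` (?X \<times> Pow ?X \<times> Pow ?X)" (is "_ \<subseteq> ?A \<union> ?B")
  proof
    fix i assume i: "i \<in> Collect (is_index tm D)"
    show "i \<in> ?A \<union> ?B"
    proof (cases i)
      case (Pro q Q)
      with i show ?thesis by auto
    next
      case (Con q Y Z)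
      with i show ?thesis by (intro UnI2 image_eqI[of _ _ "(q, Y, Z)"]) auto
    qed
  qed
  show "finite (?A \<union> ?B)"
    using finite_rule_lits[OF assms] by simp
qed

lemma finite_inj_on_infinite:
  assumes "finite A" and "infinite (UNIV :: 'b set)"
  shows "\<exists>f :: 'a \<Rightarrow> 'b. inj_on f A"
proof -
  obtain B :: "'b set" where "finite B" "card B = card A"
    using infinite_arbitrarily_large[OF assms(2)] by blast
  then show ?thesis
    using finite_same_card_bij[OF assms(1)] by (metis bij_betw_def)
qed

section \<open>Rules and well-formedness of the simulating theory\<close>

context
  fixes D :: "('a, 'l) dtheory" and tm :: bool and l :: "'a idx \<Rightarrow> 'l"
  assumes wf: "wf_theory D" and inj: "inj_on l (Collect (is_index tm D))"
begin

abbreviation "S \<equiv> sim tm l D"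

lemma gt_sim:
  "is_index tm D i \<Longrightarrow> is_index tm D j \<Longrightarrow> gt S (rule_of D l i) (rule_of D l j) \<longleftrightarrow> beats D i j"
  using inj by (auto simp: gt_def sim_def inj_on_def)

lemma Rsd_sim: "r \<in> Rsd S q \<longleftrightarrow> (\<exists>Q. is_index tm D (Pro q Q) \<and> r = rule_of D l (Pro q Q))"
proof
  assume "r \<in> Rsd S q"
  then obtain i where i: "is_index tm D i" "r = rule_of D l i" and r: "kind r \<noteq> Defeater" "head r = q"
    by (auto simp: Rsd_def sim_def)
  then show "\<exists>Q. is_index tm D (Pro q Q) \<and> r = rule_of D l (Pro q Q)"
    by (cases i) auto
next
  assume "\<exists>Q. is_index tm D (Pro q Q) \<and> r = rule_of D l (Pro q Q)"
  then show "r \<in> Rsd S q"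
    by (auto simp: Rsd_def sim_def simp del: is_index.simps split: if_splits)
qed

lemma Rall_sim:
  "s \<in> Rall S (compl q) \<longleftrightarrow> (\<exists>Q. is_index tm D (Pro (compl q) Q) \<and> s = rule_of D l (Pro (compl q) Q))
     \<or> (\<exists>Y Z. is_index tm D (Con q Y Z) \<and> s = rule_of D l (Con q Y Z))"
proof
  assume "s \<in> Rall S (compl q)"
  then obtain i where i: "is_index tm D i" "s = rule_of D l i" and r: "head s = compl q"
    by (auto simp: Rall_def sim_def)
  then show "(\<exists>Q. is_index tm D (Pro (compl q) Q) \<and> s = rule_of D l (Pro (compl q) Q))
     \<or> (\<exists>Y Z. is_index tm D (Con q Y Z) \<and> s = rule_of D l (Con q Y Z))"
    by (cases i) (auto simp del: is_index.simps)
qed (auto simp: Rall_def sim_def simp del: is_index.simps)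

lemma body_Rs_sim: "body ` Rs S q = body ` Rs D q"
proof (intro equalityI subsetI)
  fix B assume "B \<in> body ` Rs S q"
  then obtain i where "is_index tm D i" "kind (rule_of D l i) = Strict" "head (rule_of D l i) = q"
    "B = body (rule_of D l i)"
    by (auto simp: Rs_def sim_def)
  then show "B \<in> body ` Rs D q"
    by (cases i) (auto split: if_splits)
next
  fix B assume B: "B \<in> body ` Rs D q"
  then obtain r where r: "r \<in> Rs D q" "B = body r" by blast
  then have sd: "r \<in> Rsd D q" by (auto simp: Rs_def Rsd_def)
  then have "is_index tm D (Pro q B)"
    using r head_in_rule_lits body_subset_rule_lits[of r D q] by (auto simp: supporters_def)
  moreover have "body (rule_of D l (Pro q B)) = B" "kind (rule_of D l (Pro q B)) = Strict"
      "head (rule_of D l (Pro q B)) = q"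
    using B by auto
  ultimately show "B \<in> body ` Rs S q"
    by (force simp: Rs_def sim_def simp del: is_index.simps)
qed

text \<open>Following a chain of superiority backwards yields ever superior rules of D, so that a cycle
  would contradict the acyclicity of D.\<close>

lemma chain_supporter:
  assumes "(x, y) \<in> (sup S)\<^sup>+"
  shows "\<exists>q Q i. is_index tm D (Pro q Q) \<and> is_index tm D i \<and> x = l (Pro q Q) \<and> y = l i \<and>
    (\<forall>q' Q'. i = Pro q' Q' \<longrightarrow>
      (\<forall>u\<in>supporters D q' Q'. \<exists>t\<in>supporters D q Q. (rlabel t, rlabel u) \<in> (sup D)\<^sup>+))"
  using assms
proof (induction rule: trancl.induct)
  case (r_into_trancl x y)
  then obtain i j where ij: "is_index tm D i" "is_index tm D j" "beats D i j" "x = l i" "y = l j"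
    by (auto simp: sim_def)
  then obtain q Q where "i = Pro q Q" by (cases i) auto
  moreover from this ij(3) have "\<forall>q' Q'. j = Pro q' Q' \<longrightarrow>
      (\<forall>u\<in>supporters D q' Q'. \<exists>t\<in>supporters D q Q. (rlabel t, rlabel u) \<in> (sup D)\<^sup>+)"
    by (fastforce simp: gt_def)
  ultimately show ?case using ij by blast
next
  case (trancl_into_trancl x y z)
  from trancl_into_trancl.IH obtain q Q i where i: "is_index tm D (Pro q Q)" "is_index tm D i"
      "x = l (Pro q Q)" "y = l i"
    and sup: "\<And>q' Q' u. i = Pro q' Q' \<Longrightarrow> u \<in> supporters D q' Q' \<Longrightarrow>
      \<exists>t\<in>supporters D q Q. (rlabel t, rlabel u) \<in> (sup D)\<^sup>+"
    by blast
  from trancl_into_trancl.hyps obtain i' j where j: "is_index tm D i'" "is_index tm D j"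
      "beats D i' j" "y = l i'" "z = l j"
    by (auto simp: sim_def)
  have "i' = i" using inj i j by (auto simp: inj_on_def)
  \<comment> \<open>A defeater beats nothing, so only the last index of a chain can be one;
    \<open>i\<close> still beats \<open>j\<close>.\<close>
  then obtain p P where p: "i = Pro p P" using j by (cases i) auto
  have "\<exists>t\<in>supporters D q Q. (rlabel t, rlabel v) \<in> (sup D)\<^sup>+"
    if v: "j = Pro p' P'" "v \<in> supporters D p' P'" for p' P' v
  proof -
    obtain u where "u \<in> supporters D p P" "gt D u v"
      using j(3) v \<open>i' = i\<close> p by auto
    then show ?thesis using sup[OF p] by (meson gt_def trancl.trancl_into_trancl)
  qed
  then show ?case using i j by blast
qed

lemma acyclic_sim: "acyclic (sup S)"
  unfolding acyclic_def
proof (intro allI notI)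
  fix x assume "(x, x) \<in> (sup S)\<^sup>+"
  from chain_supporter[OF this] obtain q Q i where i: "is_index tm D (Pro q Q)" "is_index tm D i"
      "x = l (Pro q Q)" "x = l i"
    and sup: "\<forall>q' Q'. i = Pro q' Q' \<longrightarrow>
      (\<forall>u\<in>supporters D q' Q'. \<exists>t\<in>supporters D q Q. (rlabel t, rlabel u) \<in> (sup D)\<^sup>+)"
    by blast
  have "i = Pro q Q" using inj i by (auto simp: inj_on_def)
  with sup have sup': "\<forall>u\<in>supporters D q Q. \<exists>t\<in>supporters D q Q. (rlabel t, rlabel u) \<in> (sup D)\<^sup>+"
    by blast
  \<comment> \<open>The supporters form a finite nonempty set, whose maximal member contradicts
    \<open>sup'\<close>.\<close>
  obtain r where r: "r \<in> supporters D q Q" using i(1) by auto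
  have sub: "supporters D q Q \<subseteq> rules D" by (auto simp: supporters_def Rsd_def)
  from maximal_rule[OF wf, of r "\<lambda>t. t \<in> supporters D q Q"] r sub sup' show False
    by blast
qed

lemma wf_sim: "wf_theory S"
proof -
  have "finite (body (rule_of D l i))" if "is_index tm D i" for i
    using that finite_rule_lits[OF wf] by (cases i) (auto intro: finite_subset)
  moreover have "inj_on rlabel (rule_of D l ` Collect (is_index tm D))"
    using inj by (auto simp: inj_on_def)
  ultimately show ?thesis
    using finite_indices[OF wf] acyclic_sim by (auto simp: wf_theory_def sim_def)
qed

section \<open>Acceptance and rejection inside the simulating theory\<close>

lemma accepts_imp_pro_sim:
  assumes acc: "accepts tm D P N q"
  shows "pro False S P N q"
proof -
  \<comment> \<open>The largest applicable body: its rule overcomes every attacker on its own, as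
    individual defeat demands.\<close>
  define Q where "Q = P \<inter> rule_lits D"
  have pro: "pro True D P N q" using accepts_pro[OF acc] .
  then obtain r where r: "r \<in> Rsd D q" "body r \<subseteq> P" by (auto simp: pro_def)
  then have idx: "is_index tm D (Pro q Q)"
    using head_in_rule_lits body_subset_rule_lits[of r D q] by (auto simp: Q_def supporters_def)
  have "body s \<inter> N \<noteq> {} \<or> gt S (rule_of D l (Pro q Q)) s" if "s \<in> Rall S (compl q)" for s
  proof -
    from that consider Q' where "is_index tm D (Pro (compl q) Q')" "s = rule_of D l (Pro (compl q) Q')"
      | Y Z where "is_index tm D (Con q Y Z)" "s = rule_of D l (Con q Y Z)"
      unfolding Rall_sim by blast
    then show ?thesis
    proof cases
      case 1
      have "beats D (Pro q Q) (Pro (compl q) Q')" if "Q' \<inter> N = {}"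
      proof -
        have "\<exists>t\<in>supporters D q Q. gt D t u" if u: "u \<in> supporters D (compl q) Q'" for u
        proof -
          have "u \<in> Rall D (compl q)" "body u \<inter> N = {}"
            using u \<open>Q' \<inter> N = {}\<close> by (auto simp: supporters_def Rsd_def Rall_def)
          then obtain t where "t \<in> Rsd D q" "body t \<subseteq> P" "gt D t u"
            using pro by (auto simp: pro_def)
          then show ?thesis
            using body_subset_rule_lits[of t D q] by (auto simp: supporters_def Q_def)
        qed
        then show ?thesis by simp
      qed
      then show ?thesis using 1 gt_sim[OF idx 1(1)] by auto
    next
      case 2
      \<comment> \<open>By \<open>blocks\<close>, an accepting state either meets \<open>Z\<close>,
        so that the rule wins, or has \<open>N\<close> meet \<open>Y\<close>, so that the defeater
        is discarded.\<close>
      then have "P \<inter> Z \<noteq> {} \<or> N \<inter> Y \<noteq> {}" "Z \<subseteq> rule_lits D"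
        using acc by (auto simp: blocks_def)
      then have "Y \<inter> N \<noteq> {} \<or> Q \<inter> Z \<noteq> {}" by (auto simp: Q_def)
      then show ?thesis using 2 gt_sim[OF idx 2(1)] by auto
    qed
  qed
  moreover have "rule_of D l (Pro q Q) \<in> Rsd S q" using idx unfolding Rsd_sim by blast
  moreover have "body (rule_of D l (Pro q Q)) \<subseteq> P" by (simp add: Q_def)
  ultimately show ?thesis unfolding pro_def by (auto intro!: bexI[of _ "rule_of D l (Pro q Q)"])
qed

text \<open>For a non-accepting state, the complement state \<open>(?X - N, ?X - P)\<close> indexes
  a defeater: an accepting state compatible with it would, by monotonicity, make
  \<open>(P, N)\<close> accepting. Its body avoids \<open>N\<close>, and rules with bodies inside
  \<open>P\<close> do not beat it. The assumption \<open>q \<notin> P\<close> puts \<open>q\<close>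
  into its second component.\<close>

lemma pro_sim_imp_accepts:
  assumes pro: "pro True S P N q" and "q \<notin> P"
  shows "accepts tm D P N q"
proof (rule ccontr)
  assume neg: "\<not> accepts tm D P N q"
  let ?X = "rule_lits D"
  have q: "q \<in> ?X" using pro by (auto simp: pro_def Rsd_sim)
  have "P' \<inter> (?X - P) \<noteq> {} \<or> N' \<inter> (?X - N) \<noteq> {}" if "accepts tm D P' N' q" for P' N'
    using accepts_mono[OF that, of P N] neg by (auto simp: rule_lits_def)
  then have idx: "is_index tm D (Con q (?X - N) (?X - P))"
    using q \<open>q \<notin> P\<close> by (auto simp: blocks_def)
  then have "rule_of D l (Con q (?X - N) (?X - P)) \<in> Rall S (compl q)"
    unfolding Rall_sim by blast
  then obtain t where "t \<in> Rsd S q" "body t \<subseteq> P" "gt S t (rule_of D l (Con q (?X - N) (?X - P)))"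
    using pro by (force simp: pro_def)
  then show False
    using gt_sim[OF _ idx] by (auto simp: Rsd_sim simp del: is_index.simps)
qed

text \<open>The state restricted to \<open>rule_lits D\<close> is itself the index of the needed
  defeater: a rule that beats it meets \<open>N\<close> and is therefore discarded.\<close>

lemma rejects_imp_con_sim:
  assumes rej: "rejects tm D P N q"
  shows "con True S N P q"
proof (cases "q \<in> rule_lits D")
  case False
  then show ?thesis by (auto simp: con_def Rsd_sim)
next
  case True
  let ?Y = "P \<inter> rule_lits D" and ?Z = "N \<inter> rule_lits D"
  have rej': "rejects tm D ?Y ?Z q"
    using rej by (rule rejects_mono) (auto simp: rule_lits_def)
  then have idx: "is_index tm D (Con q ?Y ?Z)"
    using True accepts_rejects_conflict[OF _ rej'] by (auto simp: blocks_def)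
  then have "rule_of D l (Con q ?Y ?Z) \<in> Rall S (compl q)"
    unfolding Rall_sim by blast
  moreover have "body t \<inter> N \<noteq> {} \<or> \<not> gt S t (rule_of D l (Con q ?Y ?Z))" if "t \<in> Rsd S q" for t
    using that gt_sim[OF _ idx] by (auto simp: Rsd_sim simp del: is_index.simps)
  ultimately show ?thesis unfolding con_def by fastforce
qed

text \<open>Test the largest undiscarded body \<open>Q\<close>. If it has no supporters,
  \<open>N\<close> discards all rules for \<open>q\<close>. Otherwise some attacker is unbeaten: a
  \<open>Pro\<close> rule contains a rule of \<open>D\<close> that no undiscarded rule beats, and a
  defeater has its state inside \<open>(P, N)\<close>, where \<open>q \<notin> N\<close> leaves
  rejection as its only origin.\<close>

lemma con_sim_imp_rejects:
  assumes con: "con False S N P q" and "q \<notin> N"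
  shows "rejects tm D P N q"
proof -
  define Q where "Q = rule_lits D - N"
  have sub: "body t \<subseteq> Q" if "t \<in> Rsd D q" "body t \<inter> N = {}" for t
    using that body_subset_rule_lits[of t D q] by (auto simp: Q_def)
  show ?thesis
  proof (cases "is_index tm D (Pro q Q)")
    case False
    then have "\<forall>r\<in>Rsd D q. body r \<inter> N \<noteq> {}"
      using sub head_in_rule_lits by (fastforce simp: supporters_def Q_def)
    then show ?thesis by (simp add: rejects_def con_def)
  next
    case idx: True
    then have "rule_of D l (Pro q Q) \<in> Rsd S q" unfolding Rsd_sim by blast
    then obtain s where s: "s \<in> Rall S (compl q)" "body s \<subseteq> P" "\<not> gt S (rule_of D l (Pro q Q)) s"
      using con by (force simp: con_def Q_def)
    from s(1) consider Q' where "is_index tm D (Pro (compl q) Q')" "s = rule_of D l (Pro (compl q) Q')"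
      | Y Z where "is_index tm D (Con q Y Z)" "s = rule_of D l (Con q Y Z)"
      unfolding Rall_sim by blast
    then show ?thesis
    proof cases
      case 1
      then obtain u where u: "u \<in> supporters D (compl q) Q'" "\<forall>t\<in>supporters D q Q. \<not> gt D t u"
        using s(3) gt_sim[OF idx 1(1)] by auto
      have "con True D N P q"
        using 1 s(2) u sub by (force simp: con_def supporters_def Rsd_def Rall_def)
      then show ?thesis by (rule con_rejects)
    next
      case 2
      then have "Y \<subseteq> P" "Z \<subseteq> N"
        using s gt_sim[OF idx 2(1)] by (auto simp: Q_def)
      moreover from this have "rejects tm D Y Z q"
        using 2 \<open>q \<notin> N\<close> by (auto simp: blocks_def)
      ultimately show ?thesis by (auto intro: rejects_mono)
    qed
  qed
qed

end

section \<open>Agreement of the conclusions of both theories\<close>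

definition Pos :: "('a, 'l) dtheory \<Rightarrow> tag \<Rightarrow> 'a lit set" where
  "Pos D d = {a. proves D (Plus d a)}"

definition Neg :: "('a, 'l) dtheory \<Rightarrow> tag \<Rightarrow> 'a lit set" where
  "Neg D d = {a. proves D (Minus d a)}"

text \<open>From here on \<open>Pos\<close> and \<open>Neg\<close> mean sets of concluded literals
  and hide the constructors of the same names.\<close>

lemma Pos_iff:
  assumes "wf_theory D"
  shows "q \<in> Pos D (dl tm) \<longleftrightarrow> q \<in> Pos D Delta \<or> compl q \<in> Neg D Delta \<and>
      pro tm D (Pos D (dl tm)) (Neg D (sg tm)) q"
    and "q \<in> Pos D (pt tm) \<longleftrightarrow> q \<in> Pos D Delta \<or> compl q \<in> Neg D Delta \<and>
      pro tm D (Pos D (pt tm)) (Neg D (pt tm)) q"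
    and "q \<in> Pos D (sg tm) \<longleftrightarrow> q \<in> Pos D Delta \<or>
      (\<exists>r\<in>Rsd D q. body r \<subseteq> Pos D (sg tm) \<and>
        (\<forall>s\<in>Rall D (compl q). body s \<inter> Neg D (dl tm) \<noteq> {} \<or> \<not> gt D s r))"
  using proves_iff_step[OF assms, of "Plus (dl tm) q"] proves_iff_step[OF assms, of "Plus (pt tm) q"]
    proves_iff_step[OF assms, of "Plus (sg tm) q"]
  by (simp_all add: step_plus step_sg Pos_def Neg_def)

lemma Neg_iff:
  assumes "wf_theory D"
  shows "q \<in> Neg D (dl tm) \<longleftrightarrow> q \<in> Neg D Delta \<and> (compl q \<in> Pos D Delta \<or>
      con tm D (Neg D (dl tm)) (Pos D (sg tm)) q)"
    and "q \<in> Neg D (pt tm) \<longleftrightarrow> q \<in> Neg D Delta \<and> (compl q \<in> Pos D Delta \<or>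
      con tm D (Neg D (pt tm)) (Pos D (pt tm)) q)"
    and "q \<in> Neg D (sg tm) \<longleftrightarrow> q \<in> Neg D Delta \<and>
      (\<forall>r\<in>Rsd D q. body r \<inter> Neg D (sg tm) \<noteq> {} \<or>
        (\<exists>s\<in>Rall D (compl q). body s \<subseteq> Pos D (dl tm) \<and> gt D s r))"
  using proves_iff_step[OF assms, of "Minus (dl tm) q"] proves_iff_step[OF assms, of "Minus (pt tm) q"]
    proves_iff_step[OF assms, of "Minus (sg tm) q"]
  by (simp_all add: step_minus step_sg Pos_def Neg_def)

text \<open>The true +\<sigma> conclusions are closed under the clauses of \<open>splus\<close>; the
  base clause is the inclusion of +\<delta> in +\<sigma>.\<close>

lemma splus_subset_Pos:
  assumes "wf_theory D"
  shows "splus D (Pos D (dl tm)) (Neg D (dl tm)) \<subseteq> Pos D (sg tm)"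
proof
  fix a assume "a \<in> splus D (Pos D (dl tm)) (Neg D (dl tm))"
  then show "a \<in> Pos D (sg tm)"
  proof (induction rule: splus.induct)
    case (base q)
    then show ?case
      using incl_stage[OF assms, of tm] by (auto simp: Pos_def proves_stage incl_def)
  next
    case (rule r q)
    then show ?case using Pos_iff(3)[OF assms] by blast
  qed
qed

lemma sminus_subset_Neg:
  assumes "wf_theory D"
  shows "sminus D (Pos D (dl tm)) (Neg D (dl tm)) \<subseteq> Neg D (sg tm)"
proof
  fix a assume "a \<in> sminus D (Pos D (dl tm)) (Neg D (dl tm))"
  then show "a \<in> Neg D (sg tm)"
  proof (induction rule: sminus.induct)
    case (rule q)
    have "q \<in> Neg D Delta"
      using rule.hyps Neg_iff(1)[OF assms, of q tm] by simp
    moreover have "body r \<inter> Neg D (sg tm) \<noteq> {} \<or>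
        (\<exists>s\<in>Rall D (compl q). body s \<subseteq> Pos D (dl tm) \<and> gt D s r)" if "r \<in> Rsd D q" for r
      using rule that by blast
    ultimately show ?case using Neg_iff(3)[OF assms, of q tm] by simp
  qed
qed

lemma step_Delta:
  "step D E (Plus Delta q) \<longleftrightarrow> q \<in> facts D \<or> (\<exists>B\<in>body ` Rs D q. allP E Delta B)"
  "step D E (Minus Delta q) \<longleftrightarrow> q \<notin> facts D \<and> (\<forall>B\<in>body ` Rs D q. someM E Delta B)"
  by auto

lemma Delta_stage_cong:
  assumes "facts D = facts D'" and "\<And>q. body ` Rs D q = body ` Rs D' q"
  shows "(Plus Delta q \<in> stage D n \<longleftrightarrow> Plus Delta q \<in> stage D' n)
    \<and> (Minus Delta q \<in> stage D n \<longleftrightarrow> Minus Delta q \<in> stage D' n)"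
proof (induction n arbitrary: q)
  case (Suc n)
  have "allP (stage D n) Delta B = allP (stage D' n) Delta B"
    and "someM (stage D n) Delta B = someM (stage D' n) Delta B" for B
    using Suc by (auto simp: allP_def someM_def)
  then show ?case
    by (simp only: stage_Suc mem_Collect_eq step_Delta assms simp_thms)
qed simp

context
  fixes D :: "('a, 'l) dtheory" and tm tm' :: bool and l :: "'a idx \<Rightarrow> 'l"
  assumes wf: "wf_theory D" and inj: "inj_on l (Collect (is_index tm D))"
begin

lemma Delta_sim:
  "Pos (sim tm l D) Delta = Pos D Delta" "Neg (sim tm l D) Delta = Neg D Delta"
  using Delta_stage_cong[of "sim tm l D" D] body_Rs_sim[OF wf inj]
  by (simp_all add: Pos_def Neg_def proves_stage sim_def)

text \<open>The state compared with is the final one of \<open>D\<close>. A literal already in it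
  needs no argument, which supplies the side conditions \<open>q \<notin> P\<close> and
  \<open>q \<notin> N\<close> of the converse lemmas.\<close>

lemma sim_sound_stage:
  "(Plus (pt tm') q \<in> stage (sim tm l D) n \<longrightarrow> q \<in> Pos D (dl tm)) \<and>
   (Minus (pt tm') q \<in> stage (sim tm l D) n \<longrightarrow> q \<in> Neg D (dl tm))"
proof (induction n arbitrary: q)
  case (Suc n)
  let ?S = "sim tm l D" and ?P = "Pos D (dl tm)" and ?N = "Neg D (dl tm)"
  let ?P' = "{a. Plus (pt tm') a \<in> stage ?S n}" and ?N' = "{a. Minus (pt tm') a \<in> stage ?S n}"
  have sub: "?P' \<subseteq> ?P" "?N' \<subseteq> ?N" using Suc by auto
  have Delta: "Plus Delta a \<in> stage ?S n \<Longrightarrow> a \<in> Pos D Delta"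
    "Minus Delta a \<in> stage ?S n \<Longrightarrow> a \<in> Neg D Delta" for a
    using Delta_sim by (auto simp: Pos_def Neg_def proves_stage)
  have acc: "q \<in> ?P" if "compl q \<in> Neg D Delta" "pro tm' ?S ?P' ?N' q"
  proof (rule ccontr)
    assume "q \<notin> ?P"
    have "pro True ?S ?P ?N q"
      using pro_mono[OF that(2)] sub by (blast intro: pro_team)
    then have "accepts tm D ?P ?N q"
      using pro_sim_imp_accepts[OF wf inj] \<open>q \<notin> ?P\<close> by blast
    then have "pro tm D ?P (Neg D (sg tm)) q"
      unfolding accepts_def using sminus_subset_Neg[OF wf] by (blast intro: pro_mono)
    then show False using that(1) \<open>q \<notin> ?P\<close> Pos_iff(1)[OF wf] by blast
  qed
  have rej: "q \<in> ?N" if "q \<in> Neg D Delta" "con tm' ?S ?N' ?P' q"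
  proof (rule ccontr)
    assume "q \<notin> ?N"
    have "con False ?S ?N ?P q"
      using con_mono[OF that(2)] sub by (blast intro: con_individual)
    then have "rejects tm D ?P ?N q"
      using con_sim_imp_rejects[OF wf inj] \<open>q \<notin> ?N\<close> by blast
    then have "con tm D ?N (Pos D (sg tm)) q"
      unfolding rejects_def using splus_subset_Pos[OF wf] by (blast intro: con_mono)
    then show False using that(1) \<open>q \<notin> ?N\<close> Neg_iff(1)[OF wf] by blast
  qed
  show ?case
    using Delta acc rej Pos_iff(1)[OF wf] Neg_iff(1)[OF wf]
    by (auto simp: stage_Suc step_plus step_minus)
qed simp

text \<open>The induction follows the stages of \<open>D\<close> and carries the support tags along,
  placing them in the least fixed points over the final state of the simulating theory.\<close>

lemma sim_complete_stage:
  assumes "P = Pos (sim tm l D) (pt tm')" and "N = Neg (sim tm l D) (pt tm')"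
  shows "(Plus (dl tm) q \<in> stage D n \<longrightarrow> q \<in> P) \<and> (Minus (dl tm) q \<in> stage D n \<longrightarrow> q \<in> N) \<and>
    (Plus (sg tm) q \<in> stage D n \<longrightarrow> q \<in> splus D P N) \<and>
    (Minus (sg tm) q \<in> stage D n \<longrightarrow> q \<in> sminus D P N)"
proof (induction n arbitrary: q)
  case (Suc n)
  let ?S = "sim tm l D" and ?E = "stage D n"
  have sub: "{a. Plus (dl tm) a \<in> ?E} \<subseteq> P" "{a. Minus (dl tm) a \<in> ?E} \<subseteq> N"
    "{a. Plus (sg tm) a \<in> ?E} \<subseteq> splus D P N" "{a. Minus (sg tm) a \<in> ?E} \<subseteq> sminus D P N"
    using Suc by auto
  have Delta: "Plus Delta a \<in> ?E \<Longrightarrow> a \<in> Pos ?S Delta" "Minus Delta a \<in> ?E \<Longrightarrow> a \<in> Neg ?S Delta" for a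
    using Delta_sim by (auto simp: Pos_def Neg_def proves_stage)
  have P: "q \<in> P" if "q \<in> Pos ?S Delta" for q
    using that Pos_iff(2)[OF wf_sim[OF wf inj]] by (simp add: assms)
  have plus: "q \<in> P" if step: "step D ?E (Plus (dl tm) q)"
  proof (cases "Plus Delta q \<in> ?E")
    case False
    then have "accepts tm D P N q"
      unfolding accepts_def using step sub by (auto simp: step_plus intro: pro_mono)
    then have "pro tm' ?S P N q"
      using accepts_imp_pro_sim[OF wf inj] pro_individual by blast
    then show ?thesis
      using step False Delta Pos_iff(2)[OF wf_sim[OF wf inj]] by (auto simp: step_plus assms)
  qed (use Delta P in blast)
  have minus: "q \<in> N" if step: "step D ?E (Minus (dl tm) q)"
  proof (cases "Plus Delta (compl q) \<in> ?E")
    case True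
    then show ?thesis
      using step Delta Neg_iff(2)[OF wf_sim[OF wf inj]] by (auto simp: step_minus assms)
  next
    case False
    then have "rejects tm D P N q"
      unfolding rejects_def using step sub by (auto simp: step_minus intro: con_mono)
    then have "con tm' ?S N P q"
      using rejects_imp_con_sim[OF wf inj] con_team by blast
    then show ?thesis
      using step Delta Neg_iff(2)[OF wf_sim[OF wf inj]] by (auto simp: step_minus assms)
  qed
  have splus: "q \<in> splus D P N" if "step D ?E (Plus (sg tm) q)"
  proof (cases "Plus Delta q \<in> ?E")
    case True
    then show ?thesis using Delta P by (blast intro: splus.base)
  next
    case False
    with that obtain r where "r \<in> Rsd D q" "body r \<subseteq> {a. Plus (sg tm) a \<in> ?E}"
      "\<forall>s\<in>Rall D (compl q). body s \<inter> {a. Minus (dl tm) a \<in> ?E} \<noteq> {} \<or> \<not> gt D s r"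
      by (auto simp: step_sg)
    then show ?thesis using sub by (intro splus.rule[of r]) blast+
  qed
  have sminus: "q \<in> sminus D P N" if step: "step D ?E (Minus (sg tm) q)"
  proof (rule sminus.rule)
    \<comment> \<open>The premise \<open>q \<in> N\<close> of \<open>sminus\<close> comes from the
      -\<delta> step available at the same stage.\<close>
    show "q \<in> N" using minus incl_step(2)[OF wf incl_stage[OF wf] step] .
    show "\<forall>r\<in>Rsd D q. (\<exists>a\<in>body r. a \<in> sminus D P N) \<or>
        (\<exists>s\<in>Rall D (compl q). body s \<subseteq> P \<and> gt D s r)"
    proof
      fix r assume "r \<in> Rsd D q"
      then consider "body r \<inter> {a. Minus (sg tm) a \<in> ?E} \<noteq> {}"
        | s where "s \<in> Rall D (compl q)" "body s \<subseteq> {a. Plus (dl tm) a \<in> ?E}" "gt D s r"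
        using step unfolding step_sg by meson
      then show "(\<exists>a\<in>body r. a \<in> sminus D P N) \<or>
          (\<exists>s\<in>Rall D (compl q). body s \<subseteq> P \<and> gt D s r)"
      proof cases
        case 1
        then show ?thesis using sub(4) by auto
      next
        case 2
        then show ?thesis using sub(1) by (meson subset_trans)
      qed
    qed
  qed
  show ?case
    using plus minus splus sminus by (simp add: stage_Suc)
qed simp

lemma sim_correct:
  "proves D (Plus (dl tm) q) \<longleftrightarrow> proves (sim tm l D) (Plus (pt tm') q)"
  "proves D (Minus (dl tm) q) \<longleftrightarrow> proves (sim tm l D) (Minus (pt tm') q)"
  using sim_sound_stage sim_complete_stage[OF refl refl]
  by (auto simp: Pos_def Neg_def proves_stage)

end

section \<open>Commutation of the construction with added facts\<close>

lemma support_cong: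
  assumes "Rsd D = Rsd D'" "Rall D = Rall D'" "gt D = gt D'"
  shows "splus D P N \<subseteq> splus D' P N" and "sminus D P N \<subseteq> sminus D' P N"
proof safe
  fix a assume "a \<in> splus D P N"
  then show "a \<in> splus D' P N"
    by induction (simp_all add: assms splus.intros)
next
  fix a assume "a \<in> sminus D P N"
  then show "a \<in> sminus D' P N"
  proof induction
    case (rule q)
    then show ?case unfolding assms by (intro sminus.rule) blast+
  qed
qed

text \<open>Indices, superiority and strictness look only at rules and superiority, never at facts.
  Hence simulating after adding facts gives the same theory as adding them to the
  simulation.\<close>

lemma is_index_cong:
  assumes "rules D = rules D'" "sup D = sup D'"
  shows "is_index tm D = is_index tm D'" "beats D = beats D'" "rule_of D l = rule_of D' l"
proof -
  have Rs: "Rs D = Rs D'" "Rsd D = Rsd D'" "Rall D = Rall D'" "gt D = gt D'"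
    using assms by (auto simp: fun_eq_iff Rs_def Rsd_def Rall_def gt_def)
  have sup: "supporters D = supporters D'"
    by (simp add: fun_eq_iff supporters_def Rs)
  have "splus D P N = splus D' P N" "sminus D P N = sminus D' P N" for P N
    using support_cong[OF Rs(2-4)] support_cong[OF Rs(2-4)[symmetric]] by (meson subset_antisym)+
  then have "blocks tm D = blocks tm D'"
    by (simp add: fun_eq_iff blocks_def accepts_def rejects_def pro_def con_def Rs)
  moreover have "rule_lits D = rule_lits D'"
    by (simp add: rule_lits_def body_lits_def assms)
  ultimately have "is_index tm D i = is_index tm D' i" for i
    by (cases i) (simp_all add: sup)
  then show "is_index tm D = is_index tm D'" by blast
  have "beats D i j = beats D' i j" for i j
    by (cases i; cases j) (simp_all add: sup Rs)
  then show "beats D = beats D'" by blast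
  have "rule_of D l i = rule_of D' l i" for i
    by (cases i) (simp_all add: rule_of.simps Rs)
  then show "rule_of D l = rule_of D' l" by blast
qed

lemma add_facts:
  assumes "facts_only A"
  shows "rules (add_th D A) = rules D" "sup (add_th D A) = sup D"
  using assms by (auto simp: facts_only_def add_th_def)

lemma sim_add_facts:
  assumes "facts_only A"
  shows "add_th (sim tm l D) A = sim tm l (add_th D A)"
  using assms is_index_cong[OF add_facts[OF assms]]
  by (simp add: sim_def add_th_def facts_only_def)

theorem theorem5:
  fixes D1 :: "('a, 'l) dtheory" and d1 d2 :: tag
  assumes "infinite (UNIV :: 'a set)" and "infinite (UNIV :: 'l set)"
    and "d1 \<in> {Dl, DlS}" and "d2 \<in> {Partial, PartialS}"
    and "wf_theory D1"
  shows "\<exists>D2. wf_theory D2 \<and> simulated_wrt facts_only d1 D1 d2 D2"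
proof -
  define tm where "tm = (d1 = Dl)"
  define tm' where "tm' = (d2 = Partial)"
  have d: "d1 = dl tm" "d2 = pt tm'"
    using assms(3,4) by (auto simp: tm_def tm'_def dl_def pt_def)
  \<comment> \<open>The infinite label type provides distinct labels for the finitely many
    indices.\<close>
  obtain l :: "'a idx \<Rightarrow> 'l" where inj: "inj_on l (Collect (is_index tm D1))"
    using finite_inj_on_infinite[OF finite_indices[OF assms(5)] assms(2)] by blast
  have "simulated_wrt facts_only d1 D1 d2 (sim tm l D1)"
    unfolding simulated_wrt_def
  proof (intro allI impI ballI)
    fix A :: "('a, 'l) dtheory" and q
    assume "facts_only A \<and> modular D1 (sim tm l D1) A"
    then have A: "facts_only A" by simp
    \<comment> \<open>\<open>D1 + A\<close> is again well-formed with the same indices, so the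
      correctness result applies to it in place of \<open>D1\<close>.\<close>
    have "wf_theory (add_th D1 A)"
      using assms(5) by (simp add: wf_theory_def add_facts[OF A])
    moreover have "inj_on l (Collect (is_index tm (add_th D1 A)))"
      using inj is_index_cong(1)[OF add_facts[OF A]] by simp
    ultimately show "(proves (add_th D1 A) (Plus d1 q) \<longleftrightarrow> proves (add_th (sim tm l D1) A) (Plus d2 q)) \<and>
        (proves (add_th D1 A) (Minus d1 q) \<longleftrightarrow> proves (add_th (sim tm l D1) A) (Minus d2 q))"
      unfolding d sim_add_facts[OF A] using sim_correct by blast
  qed
  then show ?thesis using wf_sim[OF assms(5) inj] by blast
qed

end
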